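(* Let $D=(V,A)$ be a finite directed graph, $\{S,T\}$ a partition of $V$ into nonempty sets with no arc $uv\in A$ having $u\in T$, $v\in S$, and $w\in\mathbb{Z}_+^{A}$. Let $x\in\{0,1\}^A$ be an optimal solution of the linear program (P) and let $(y,z)\in \mathbb{Z}^{2^S\setminus\{\emptyset\}}\times\mathbb{Z}^{2^T\setminus\{\emptyset\}}$ be an optimal solution of its dual (D). Define $\xi^*\in\{0,1\}^{A[S,T]}$, $p^*\in\mathbb{Z}^S$, $q^*\in\mathbb{Z}^T$ by $$\xi^*(a)=x(a)\ (a\in A[S,T]),\qquad p^*(u)=-\sum_{S'\subseteq S,\ u\in S'}y(S')\ (u\in S),\qquad q^*(v)=\sum_{T'\subseteq T,\ v\in T'}z(T')\ (v\in T).$$ Then $\xi^*$ is an optimal flow for (MSF) and $(p^*,q^* )$ is an optimal potential for (MSF).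
   Context: Notation: an arc $uv$ leaves $u$ and enters $v$. For $X\subseteq V$, $\delta^+X=\{uv\in A: u\in X, v\notin X\}$, $\delta^-X=\{uv\in A: u\notin X, v\in X\}$; $\delta^{\pm}u=\delta^{\pm}\{u\}$. $A[X]$ denotes arcs with both ends in $X$, $A[S,T]=\{uv\in A: u\in S, v\in T\}$, so $A=A[S]\cup A[T]\cup A[S,T]$; $D[S]=(S,A[S])$, $D[T]=(T,A[T])$. (P): minimize $\sum_{a\in A}w(a)x(a)$ over $x\in\mathbb{R}^A$ subject to $\sum_{a\in\delta^+S'}x(a)\ge1$ for all $\emptyset\ne S'\subseteq S$, $\sum_{a\in\delta^-T'}x(a)\ge1$ for all $\emptyset\ne T'\subseteq T$, $x\ge0$. (D): maximize $\sum_{\emptyset\ne S'\subseteq S}y(S')+\sum_{\emptyset\ne T'\subseteq T}z(T')$ subject to $\sum_{S'\subseteq S,\,a\in\delta^+S'}y(S')+\sum_{T'\subseteq T,\,a\in\delta^-T'}z(T')\le w(a)$ for all $a\in A$, and $y\ge0$, $z\ge0$. A branching is an arc set with no directed cycle in which every vertex is entered by at most one arc; for a branching $B$ in $D[T]$, $R(B)$ is the set of vertices of $T$ entered by no arc of $B$. A cobranching is an arc set whose reversal is a branching; for a cobranching $B$ in $D[S]$, $R^*(B)$ is the set of vertices of $S$ left by no arc of $B$. For $\eta\in\mathbb{Z}^X$, $\mathrm{supp}^+(\eta)=\{u\in X:\eta(u)>0\}$. Define $g_T:\mathbb{Z}^T\to\mathbb{Z}\cup\{+\infty\}$ by $g_T(\eta)=\min\{w(B):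 B \text{ branching in } D[T],\ R(B)=\mathrm{supp}^+(\eta)\}$ if $\eta\in\mathbb{Z}_+^T$ and such a branching exists, and $g_T(\eta)=+\infty$ otherwise; define $g_S:\mathbb{Z}^S\to\mathbb{Z}\cup\{+\infty\}$ analogously using cobranchings $B$ in $D[S]$ with $R^*(B)=\mathrm{supp}^+(\eta)$, $\eta\in\mathbb{Z}_+^S$. $\mathrm{dom}\,g=\{\eta: g(\eta)<+\infty\}$. For $\xi\in\{0,1\}^{A[S,T]}$ let $\partial\xi(v)=|\{a\in\delta^+v:\xi(a)=1\}|-|\{a\in\delta^-v:\xi(a)=1\}|$ for $v\in V$ (only arcs of $A[S,T]$ counted), with restrictions $\partial\xi|_S$, $\partial\xi|_T$. $\xi$ is feasible if $\partial\xi|_S\in\mathrm{dom}\,g_S$ and $-\partial\xi|_T\in\mathrm{dom}\,g_T$. Problem (MSF): minimize $\sum_{a\in A[S,T]}w(a)\xi(a)+g_S(\partial\xi|_S)+g_T(-\partial\xi|_T)$ over $\xi\in\{0,1\}^{A[S,T]}$; an optimal flow is a feasible $\xi$ attaining the minimum. For $p\in\mathbb{Z}^S$, $q\in\mathbb{Z}^T$ let $g_S[-p](\eta)=g_S(\eta)-\sum_{u\in S}p(u)\eta(u)$ and $g_T[+q](\zeta)=g_T(\zeta)+\sum_{v\in T}q(v)\zeta(v)$. A pair $(p,q)\in\mathbb{Z}^S\times\mathbb{Z}^T$ is an optimal potential for (MSF) if there is a feasible $\xi\in\{0,1\}^{A[S,T]}$ such that: (i) for every $a=uv\in A[S,T]$,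 $\xi(a)=1\Rightarrow w(a)+p(u)-q(v)\le0$ and $\xi(a)=0\Rightarrow w(a)+p(u)-q(v)\ge0$; (ii) $\partial\xi|_S\in\arg\min g_S[-p]$; (iii) $-\partial\xi|_T\in\arg\min g_T[+q]$. *)

theory Defs
  imports
    Complex_Main
    "HOL-Library.Extended"
    "Graph_Theory.Digraph_Component"
begin

text \<open>
  Digraphs may have loops and parallel arcs.  A vector indexed by a finite set X is a total
  function of which only the values on X matter: every definition below inspects it on X only.
\<close>

definition delta_out :: "('a,'b) pre_digraph \<Rightarrow> 'a set \<Rightarrow> 'b set" where
  "delta_out G X = {a \<in> arcs G. tail G a \<in> X \<and> head G a \<notin> X}"

definition delta_in :: "('a,'b) pre_digraph \<Rightarrow> 'a set \<Rightarrow> 'b set" where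
  "delta_in G X = {a \<in> arcs G. tail G a \<notin> X \<and> head G a \<in> X}"

definition arcs_between :: "('a,'b) pre_digraph \<Rightarrow> 'a set \<Rightarrow> 'a set \<Rightarrow> 'b set" where
  "arcs_between G S T = {a \<in> arcs G. tail G a \<in> S \<and> head G a \<in> T}"

definition primal_feasible ::
    "('a,'b) pre_digraph \<Rightarrow> 'a set \<Rightarrow> 'a set \<Rightarrow> ('b \<Rightarrow> real) \<Rightarrow> bool" where
  "primal_feasible G S T x \<longleftrightarrow>
     (\<forall>S'. S' \<noteq> {} \<and> S' \<subseteq> S \<longrightarrow> (\<Sum>a\<in>delta_out G S'. x a) \<ge> 1) \<and>
     (\<forall>T'. T' \<noteq> {} \<and> T' \<subseteq> T \<longrightarrow> (\<Sum>a\<in>delta_in G T'. x a) \<ge> 1) \<and>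
     (\<forall>a\<in>arcs G. x a \<ge> 0)"

definition primal_optimal ::
    "('a,'b) pre_digraph \<Rightarrow> ('b \<Rightarrow> int) \<Rightarrow> 'a set \<Rightarrow> 'a set \<Rightarrow> ('b \<Rightarrow> real) \<Rightarrow> bool" where
  "primal_optimal G w S T x \<longleftrightarrow>
     is_arg_min (\<lambda>x. \<Sum>a\<in>arcs G. real_of_int (w a) * x a) (primal_feasible G S T) x"

definition dual_feasible ::
    "('a,'b) pre_digraph \<Rightarrow> ('b \<Rightarrow> int) \<Rightarrow> 'a set \<Rightarrow> 'a set \<Rightarrow>
     ('a set \<Rightarrow> real) \<times> ('a set \<Rightarrow> real) \<Rightarrow> bool" where
  "dual_feasible G w S T = (\<lambda>(y, z).
     (\<forall>a\<in>arcs G.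
        (\<Sum>S' | S' \<noteq> {} \<and> S' \<subseteq> S \<and> a \<in> delta_out G S'. y S') +
        (\<Sum>T' | T' \<noteq> {} \<and> T' \<subseteq> T \<and> a \<in> delta_in G T'. z T') \<le> real_of_int (w a)) \<and>
     (\<forall>S'. S' \<noteq> {} \<and> S' \<subseteq> S \<longrightarrow> y S' \<ge> 0) \<and>
     (\<forall>T'. T' \<noteq> {} \<and> T' \<subseteq> T \<longrightarrow> z T' \<ge> 0))"

definition dual_optimal ::
    "('a,'b) pre_digraph \<Rightarrow> ('b \<Rightarrow> int) \<Rightarrow> 'a set \<Rightarrow> 'a set \<Rightarrow>
     ('a set \<Rightarrow> real) \<times> ('a set \<Rightarrow> real) \<Rightarrow> bool" where
  "dual_optimal G w S T yz \<longleftrightarrow>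
     is_arg_max
       (\<lambda>(y, z). (\<Sum>S' | S' \<noteq> {} \<and> S' \<subseteq> S. y S') + (\<Sum>T' | T' \<noteq> {} \<and> T' \<subseteq> T. z T'))
       (dual_feasible G w S T) yz"

definition branching :: "('a,'b) pre_digraph \<Rightarrow> 'b set \<Rightarrow> bool" where
  "branching H B \<longleftrightarrow>
     B \<subseteq> arcs H \<and>
     \<not> (\<exists>p. pre_digraph.cycle H p \<and> set p \<subseteq> B) \<and>
     (\<forall>v\<in>verts H. card (in_arcs H v \<inter> B) \<le> 1)"

definition roots :: "('a,'b) pre_digraph \<Rightarrow> 'b set \<Rightarrow> 'a set" where
  "roots H B = {v \<in> verts H. in_arcs H v \<inter> B = {}}"

definition reverse_digraph :: "('a,'b) pre_digraph \<Rightarrow> ('a,'b) pre_digraph" where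
  "reverse_digraph H = \<lparr>verts = verts H, arcs = arcs H, tail = head H, head = tail H\<rparr>"

definition cobranching :: "('a,'b) pre_digraph \<Rightarrow> 'b set \<Rightarrow> bool" where
  "cobranching H B \<longleftrightarrow> branching (reverse_digraph H) B"

definition coroots :: "('a,'b) pre_digraph \<Rightarrow> 'b set \<Rightarrow> 'a set" where
  "coroots H B = {v \<in> verts H. out_arcs H v \<inter> B = {}}"

definition supp_plus :: "'a set \<Rightarrow> ('a \<Rightarrow> int) \<Rightarrow> 'a set" where
  "supp_plus X \<eta> = {u \<in> X. \<eta> u > 0}"

text \<open>Integers with \<open>+\<infinity>\<close> are modelled by \<open>int extended\<close>; the value \<open>Minf\<close> is never taken.\<close>

definition g_T ::
    "('a,'b) pre_digraph \<Rightarrow> ('b \<Rightarrow> int) \<Rightarrow> 'a set \<Rightarrow> ('a \<Rightarrow> int) \<Rightarrow> int extended" where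
  "g_T G w T \<eta> =
     (let \<B> = {B. branching (G \<restriction> T) B \<and> roots (G \<restriction> T) B = supp_plus T \<eta>}
      in if (\<forall>v\<in>T. \<eta> v \<ge> 0) \<and> \<B> \<noteq> {} then Fin (Min ((\<lambda>B. \<Sum>a\<in>B. w a) ` \<B>)) else Pinf)"

definition g_S ::
    "('a,'b) pre_digraph \<Rightarrow> ('b \<Rightarrow> int) \<Rightarrow> 'a set \<Rightarrow> ('a \<Rightarrow> int) \<Rightarrow> int extended" where
  "g_S G w S \<eta> =
     (let \<B> = {B. cobranching (G \<restriction> S) B \<and> coroots (G \<restriction> S) B = supp_plus S \<eta>}
      in if (\<forall>u\<in>S. \<eta> u \<ge> 0) \<and> \<B> \<noteq> {} then Fin (Min ((\<lambda>B. \<Sum>a\<in>B. w a) ` \<B>)) else Pinf)"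

definition effective_dom :: "('c \<Rightarrow> int extended) \<Rightarrow> 'c set" where
  "effective_dom g = {\<eta>. g \<eta> < Pinf}"

definition g_S_shift ::
    "('a,'b) pre_digraph \<Rightarrow> ('b \<Rightarrow> int) \<Rightarrow> 'a set \<Rightarrow> ('a \<Rightarrow> int) \<Rightarrow> ('a \<Rightarrow> int) \<Rightarrow> int extended" where
  "g_S_shift G w S p \<eta> = g_S G w S \<eta> - Fin (\<Sum>u\<in>S. p u * \<eta> u)"

definition g_T_shift ::
    "('a,'b) pre_digraph \<Rightarrow> ('b \<Rightarrow> int) \<Rightarrow> 'a set \<Rightarrow> ('a \<Rightarrow> int) \<Rightarrow> ('a \<Rightarrow> int) \<Rightarrow> int extended" where
  "g_T_shift G w T q \<zeta> = g_T G w T \<zeta> + Fin (\<Sum>v\<in>T. q v * \<zeta> v)"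

definition boundary ::
    "('a,'b) pre_digraph \<Rightarrow> 'a set \<Rightarrow> 'a set \<Rightarrow> ('b \<Rightarrow> int) \<Rightarrow> 'a \<Rightarrow> int" where
  "boundary G S T \<xi> v =
     int (card {a \<in> delta_out G {v} \<inter> arcs_between G S T. \<xi> a = 1}) -
     int (card {a \<in> delta_in G {v} \<inter> arcs_between G S T. \<xi> a = 1})"

definition binary_flow :: "('a,'b) pre_digraph \<Rightarrow> 'a set \<Rightarrow> 'a set \<Rightarrow> ('b \<Rightarrow> int) \<Rightarrow> bool" where
  "binary_flow G S T \<xi> \<longleftrightarrow> (\<forall>a\<in>arcs_between G S T. \<xi> a \<in> {0, 1})"

definition feasible_flow ::
    "('a,'b) pre_digraph \<Rightarrow> ('b \<Rightarrow> int) \<Rightarrow> 'a set \<Rightarrow> 'a set \<Rightarrow> ('b \<Rightarrow> int) \<Rightarrow> bool" where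
  "feasible_flow G w S T \<xi> \<longleftrightarrow>
     binary_flow G S T \<xi> \<and>
     boundary G S T \<xi> \<in> effective_dom (g_S G w S) \<and>
     - boundary G S T \<xi> \<in> effective_dom (g_T G w T)"

definition msf_cost ::
    "('a,'b) pre_digraph \<Rightarrow> ('b \<Rightarrow> int) \<Rightarrow> 'a set \<Rightarrow> 'a set \<Rightarrow> ('b \<Rightarrow> int) \<Rightarrow> int extended" where
  "msf_cost G w S T \<xi> =
     Fin (\<Sum>a\<in>arcs_between G S T. w a * \<xi> a) +
     g_S G w S (boundary G S T \<xi>) + g_T G w T (- boundary G S T \<xi>)"

definition optimal_flow ::
    "('a,'b) pre_digraph \<Rightarrow> ('b \<Rightarrow> int) \<Rightarrow> 'a set \<Rightarrow> 'a set \<Rightarrow> ('b \<Rightarrow> int) \<Rightarrow> bool" where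
  "optimal_flow G w S T \<xi> \<longleftrightarrow>
     feasible_flow G w S T \<xi> \<and> is_arg_min (msf_cost G w S T) (binary_flow G S T) \<xi>"

definition optimal_potential ::
    "('a,'b) pre_digraph \<Rightarrow> ('b \<Rightarrow> int) \<Rightarrow> 'a set \<Rightarrow> 'a set \<Rightarrow>
     ('a \<Rightarrow> int) \<times> ('a \<Rightarrow> int) \<Rightarrow> bool" where
  "optimal_potential G w S T = (\<lambda>(p, q). \<exists>\<xi>.
     feasible_flow G w S T \<xi> \<and>
     (\<forall>a\<in>arcs_between G S T.
        (\<xi> a = 1 \<longrightarrow> w a + p (tail G a) - q (head G a) \<le> 0) \<and>
        (\<xi> a = 0 \<longrightarrow> w a + p (tail G a) - q (head G a) \<ge> 0)) \<and>
     is_arg_min (g_S_shift G w S p) (\<lambda>_. True) (boundary G S T \<xi>) \<and>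
     is_arg_min (g_T_shift G w T q) (\<lambda>_. True) (- boundary G S T \<xi>))"

end

theory Submission
  imports Defs
begin

text \<open>
  For every binary flow, the cost splits into the reduced cost \<open>\<Sum>(w + p - q) \<xi>\<close> and the shifted values
  \<open>g_S[-p]\<close> and \<open>g_T[+q]\<close>, which are at least \<open>0\<close>, \<open>\<Sum>y\<close> and \<open>\<Sum>z\<close> by feasibility of \<open>(y, z)\<close>.
  Conversely, the arcs with \<open>x = 1\<close> contain branchings with the prescribed roots, so the cost of
  \<open>\<xi>\<close> is at most \<open>w \<cdot> x\<close>.  By strong duality \<open>w \<cdot> x\<close> is at most \<open>\<Sum>y + \<Sum>z\<close>, so all
  these inequalities are equalities.  Strong duality comes from Farkas' lemma, by Bartl's
  induction on the number of constraints.
\<close>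

section \<open>Linear programming duality\<close>

text \<open>Induction on the rows, with \<open>A\<close> and \<open>c\<close> arbitrary because the
  step changes both. If \<open>c\<close> stays nonnegative on the cone without row \<open>m\<close>,
  that row gets multiplier 0. Otherwise a violating direction serves to project onto the kernel of
  row \<open>m\<close>, where the induction hypothesis yields multipliers for the remaining
  rows.\<close>

lemma farkas:
  fixes A :: "'i \<Rightarrow> 'j \<Rightarrow> real" and c :: "'j \<Rightarrow> real"
  assumes "finite I" and "finite J"
    and "\<And>x. (\<And>i. i \<in> I \<Longrightarrow> (\<Sum>j\<in>J. A i j * x j) \<ge> 0) \<Longrightarrow> (\<Sum>j\<in>J. c j * x j) \<ge> 0"
  obtains l where "\<And>i. i \<in> I \<Longrightarrow> l i \<ge> 0" and "\<And>j. j \<in> J \<Longrightarrow> c j = (\<Sum>i\<in>I. l i * A i j)"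
proof -
  have "\<exists>l. (\<forall>i\<in>I. l i \<ge> 0) \<and> (\<forall>j\<in>J. c j = (\<Sum>i\<in>I. l i * A i j))"
    using assms(1,3)
  proof (induction I arbitrary: A c rule: finite_induct)
    case empty
    \<comment> \<open>Without rows every point satisfies the premise; testing at \<open>- c\<close>
      forces the squared norm of \<open>c\<close> to vanish.\<close>
    have "(\<Sum>j\<in>J. c j * - c j) \<ge> 0"
      using empty.prems[of "\<lambda>j. - c j"] by simp
    moreover have "(\<Sum>j\<in>J. c j * - c j) = - (\<Sum>j\<in>J. c j * c j)"
      by (simp add: sum_negf)
    ultimately have "(\<Sum>j\<in>J. c j * c j) = 0"
      by (smt (verit) sum_nonneg zero_le_square)
    then have "\<forall>j\<in>J. c j = 0"
      using \<open>finite J\<close> by (simp add: sum_nonneg_eq_0_iff)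
    then show ?case by simp
  next
    case (insert m I)
    define ev where "ev f x = (\<Sum>j\<in>J. f j * x j)" for f x :: "'j \<Rightarrow> real"
    have ev_lin: "ev f (\<lambda>j. x j + t * y j) = ev f x + t * ev f y"
      and ev_lin': "ev (\<lambda>j. f j + t * g j) x = ev f x + t * ev g x" for f g x y t
      by (simp_all add: ev_def algebra_simps sum.distrib sum_distrib_left)
    have prem: "ev c x \<ge> 0" if "\<And>i. i \<in> insert m I \<Longrightarrow> ev (A i) x \<ge> 0" for x
      using insert.prems[of x] that by (simp add: ev_def)
    show ?case
    proof (cases "\<forall>x. (\<forall>i\<in>I. ev (A i) x \<ge> 0) \<longrightarrow> ev c x \<ge> 0")
      case True
      then obtain l where l: "\<forall>i\<in>I. l i \<ge> 0" "\<forall>j\<in>J. c j = (\<Sum>i\<in>I. l i * A i j)"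
        using insert.IH[of A c] unfolding ev_def by blast
      have "(\<Sum>i\<in>insert m I. (l(m := 0)) i * A i j) = (\<Sum>i\<in>I. l i * A i j)" for j
        using insert.hyps by (auto intro!: sum.cong)
      with l show ?thesis by (intro exI[of _ "l(m := 0)"]) auto
    next
      case False
      then obtain x0 where x0: "\<And>i. i \<in> I \<Longrightarrow> ev (A i) x0 \<ge> 0" "ev c x0 < 0" by force
      have neg: "ev (A m) x0 < 0"
        using prem[of x0] x0 by force
      \<comment> \<open>\<open>x1\<close> is a positive multiple of \<open>x0\<close>, scaled so
        that row \<open>m\<close> takes the value -1. The summand 0 gives it the shape expected by
        \<open>ev_lin\<close>.\<close>
      define x1 where "x1 = (\<lambda>j. 0 + (- 1 / ev (A m) x0) * x0 j)"
      have ev_x1: "ev f x1 = (- 1 / ev (A m) x0) * ev f x0" for f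
        using ev_lin[of f "\<lambda>_. 0" "- 1 / ev (A m) x0" x0] by (simp add: x1_def ev_def)
      have x1: "\<And>i. i \<in> I \<Longrightarrow> ev (A i) x1 \<ge> 0" "ev c x1 < 0" "ev (A m) x1 = - 1"
        unfolding ev_x1 using x0 neg
        by (auto simp: divide_nonneg_neg divide_nonpos_neg divide_neg_neg mult_less_0_iff)
      \<comment> \<open>\<open>A'\<close> and \<open>c'\<close> are the old functionals composed
        with the projection of \<open>x\<close> along \<open>x1\<close> onto the kernel of row
        \<open>m\<close>.\<close>
      define A' where "A' = (\<lambda>i j. A i j + ev (A i) x1 * A m j)"
      define c' where "c' = (\<lambda>j. c j + ev c x1 * A m j)"
      have "ev c' x \<ge> 0" if "\<And>i. i \<in> I \<Longrightarrow> ev (A' i) x \<ge> 0" for x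
      proof -
        let ?x = "\<lambda>j. x j + ev (A m) x * x1 j"
        have m: "ev (A m) ?x = 0" and i: "\<And>i. ev (A i) ?x = ev (A' i) x" and c: "ev c ?x = ev c' x"
          using x1(3) by (simp_all add: ev_lin ev_lin' A'_def c'_def)
        have "ev c ?x \<ge> 0"
        proof (rule prem)
          fix k assume "k \<in> insert m I"
          then show "ev (A k) ?x \<ge> 0" using m i[of k] that[of k] by (cases "k = m") auto
        qed
        then show ?thesis by (simp only: c)
      qed
      then obtain l where l: "\<forall>i\<in>I. l i \<ge> 0" "\<forall>j\<in>J. c' j = (\<Sum>i\<in>I. l i * A' i j)"
        using insert.IH[of A' c'] unfolding ev_def by blast
      \<comment> \<open>\<open>r\<close> is the coefficient of \<open>A m\<close> once the
        representation of \<open>c'\<close> is solved for \<open>c\<close>. It is nonnegative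
        because \<open>x1\<close> keeps the rows in \<open>I\<close> nonnegative and makes
        \<open>c\<close> negative.\<close>
      define r where "r = (\<Sum>i\<in>I. l i * ev (A i) x1) - ev c x1"
      have "r \<ge> 0"
        unfolding r_def using l(1) x1 by (smt (verit) mult_nonneg_nonneg sum_nonneg)
      have "c j = (\<Sum>i\<in>insert m I. (l(m := r)) i * A i j)" if "j \<in> J" for j
      proof -
        have "(\<Sum>i\<in>insert m I. (l(m := r)) i * A i j) = r * A m j + (\<Sum>i\<in>I. l i * A i j)"
          using insert.hyps by (auto intro!: sum.cong)
        moreover have "c j + ev c x1 * A m j
            = (\<Sum>i\<in>I. l i * A i j) + (\<Sum>i\<in>I. l i * ev (A i) x1) * A m j"
          using l(2) that
          by (simp add: c'_def A'_def algebra_simps sum.distrib sum_distrib_left)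
        ultimately show ?thesis by (simp add: r_def algebra_simps)
      qed
      with l(1) \<open>r \<ge> 0\<close> show ?thesis by (intro exI[of _ "l(m := r)"]) auto
    qed
  qed
  with that show thesis by blast
qed

text \<open>Optimality of \<open>x\<close> makes the optimal value, homogenised as a linear
  inequality, a consequence of the homogenised constraints. The multipliers that Farkas' lemma gives
  for it form the dual solution.\<close>

lemma lp_strong_duality:
  fixes A :: "'i \<Rightarrow> 'j \<Rightarrow> real" and b :: "'i \<Rightarrow> real" and c :: "'j \<Rightarrow> real"
    and I :: "'i set" and J :: "'j set"
  defines "feas x \<equiv> (\<forall>i\<in>I. (\<Sum>j\<in>J. A i j * x j) \<ge> b i) \<and> (\<forall>j\<in>J. x j \<ge> 0)"
  assumes fin: "finite I" "finite J"
    and opt: "feas x" "\<And>x'. feas x' \<Longrightarrow> (\<Sum>j\<in>J. c j * x j) \<le> (\<Sum>j\<in>J. c j * x' j)"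
  obtains l where "\<And>i. i \<in> I \<Longrightarrow> l i \<ge> 0" and "\<And>j. j \<in> J \<Longrightarrow> (\<Sum>i\<in>I. l i * A i j) \<le> c j"
    and "(\<Sum>i\<in>I. l i * b i) \<ge> (\<Sum>j\<in>J. c j * x j)"
proof -
  text \<open>Homogenise: the column \<open>None\<close> carries the right-hand side, and the row \<open>Inr j\<close> says that
    the \<open>j\<close>-th variable is nonnegative.\<close>
  define v where "v = (\<Sum>j\<in>J. c j * x j)"
  define J' where "J' = insert None (Some ` J)"
  define I' where "I' = I <+> J'"
  define A' where "A' = (\<lambda>k j. case k of
      Inl i \<Rightarrow> (case j of None \<Rightarrow> - b i | Some j \<Rightarrow> A i j)
    | Inr j' \<Rightarrow> of_bool (j = j'))"
  define c' where "c' = case_option (- v) c"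
  have finJ': "finite J'" and finI': "finite I'"
    using fin by (simp_all add: J'_def I'_def)
  have sumJ': "(\<Sum>j\<in>J'. f j) = f None + (\<Sum>j\<in>J. f (Some j))" for f :: "'j option \<Rightarrow> real"
    using fin by (simp add: J'_def sum.reindex)
  have "(\<Sum>j\<in>J'. c' j * d j) \<ge> 0"
    if d: "\<And>k. k \<in> I' \<Longrightarrow> (\<Sum>j\<in>J'. A' k j * d j) \<ge> 0" for d
  proof -
    define t where "t = d None"
    define e where "e = (\<lambda>j. d (Some j))"
    have dJ: "d j \<ge> 0" if "j \<in> J'" for j
      using d[of "Inr j"] that finJ' by (simp add: A'_def I'_def InrI if_distrib cong: if_cong)
    have t: "t \<ge> 0" and e: "\<And>j. j \<in> J \<Longrightarrow> e j \<ge> 0"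
      using dJ by (auto simp: J'_def t_def e_def)
    have Ae: "(\<Sum>j\<in>J. A i j * e j) \<ge> b i * t" if "i \<in> I" for i
      using d[of "Inl i"] that by (simp add: A'_def I'_def sumJ' t_def e_def InlI)
    \<comment> \<open>If \<open>t = 0\<close>, then \<open>e\<close> is a recession direction and
      \<open>x + e\<close> is feasible, so \<open>e\<close> cannot have negative cost. If
      \<open>t > 0\<close>, then \<open>e / t\<close> is feasible and costs at least
      \<open>v\<close>.\<close>
    have "(\<Sum>j\<in>J. c j * e j) \<ge> v * t"
    proof (cases "t = 0")
      case True
      have "(\<Sum>j\<in>J. A i j * (x j + e j)) \<ge> b i" if "i \<in> I" for i
      proof -
        have "(\<Sum>j\<in>J. A i j * (x j + e j)) = (\<Sum>j\<in>J. A i j * x j) + (\<Sum>j\<in>J. A i j * e j)"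
          by (simp add: distrib_left sum.distrib)
        moreover have "(\<Sum>j\<in>J. A i j * x j) \<ge> b i" using opt(1) that by (simp add: feas_def)
        ultimately show ?thesis using Ae[OF that] True by simp
      qed
      then have "feas (\<lambda>j. x j + e j)"
        using opt(1) e by (simp add: feas_def)
      from opt(2)[OF this] True show ?thesis by (simp add: algebra_simps sum.distrib)
    next
      case False
      with t have "t > 0" by simp
      have "feas (\<lambda>j. e j / t)"
        using e Ae \<open>t > 0\<close> by (auto simp: feas_def field_simps simp flip: sum_divide_distrib)
      from opt(2)[OF this] \<open>t > 0\<close> show ?thesis
        by (auto simp: v_def field_simps simp flip: sum_divide_distrib)
    qed
    then show ?thesis by (simp add: sumJ' c'_def t_def e_def)
  qed
  then obtain l where l: "\<And>k. k \<in> I' \<Longrightarrow> l k \<ge> 0"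
      "\<And>j. j \<in> J' \<Longrightarrow> c' j = (\<Sum>k\<in>I'. l k * A' k j)"
    using farkas[OF finI' finJ', of A' c'] by blast
  \<comment> \<open>Among the sign rows only row \<open>j\<close> contributes to column
    \<open>j\<close>, as a slack \<open>l (Inr j)\<close>. Its nonnegativity turns the equations
    into the dual constraints for the columns \<open>Some j\<close> and into the bound on the dual
    value for \<open>None\<close>.\<close>
  have c': "c' j = (\<Sum>i\<in>I. l (Inl i) * A' (Inl i) j) + l (Inr j)" if "j \<in> J'" for j
  proof -
    have "c' j = (\<Sum>i\<in>I. l (Inl i) * A' (Inl i) j) + (\<Sum>j'\<in>J'. l (Inr j') * of_bool (j = j'))"
      using l(2)[OF that] fin finJ' unfolding I'_def by (simp add: sum.Plus A'_def)
    then show ?thesis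
      using that finJ' by (simp add: if_distrib cong: if_cong)
  qed
  have pos: "l (Inr j) \<ge> 0" if "j \<in> J'" for j
    using l(1)[of "Inr j"] that by (simp add: I'_def InrI)
  show thesis
  proof
    show "l (Inl i) \<ge> 0" if "i \<in> I" for i
      using l(1)[of "Inl i"] that by (simp add: I'_def InlI)
    show "(\<Sum>i\<in>I. l (Inl i) * A i j) \<le> c j" if "j \<in> J" for j
      using c'[of "Some j"] pos[of "Some j"] that by (simp add: J'_def A'_def c'_def)
    show "(\<Sum>i\<in>I. l (Inl i) * b i) \<ge> (\<Sum>j\<in>J. c j * x j)"
      using c'[of None] pos[of None] by (simp add: J'_def A'_def c'_def v_def sum_negf)
  qed
qed

section \<open>Branchings\<close>

text \<open>Translates the absence of cycles, given as arc lists, into acyclicity of a relation on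
  vertices. A closed walk in the subgraph with arc set \<open>B\<close> contains a cycle, and that
  is also a cycle of \<open>H\<close>.\<close>

lemma acyclic_arcs:
  assumes "wf_digraph H" and "B \<subseteq> arcs H" and "\<not> (\<exists>p. pre_digraph.cycle H p \<and> set p \<subseteq> B)"
  shows "acyclic ((\<lambda>a. (tail H a, head H a)) ` B)"
proof -
  define H' where "H' = H\<lparr>arcs := B\<rparr>"
  interpret H: wf_digraph H by fact
  interpret H': wf_digraph H'
    using assms(2) by unfold_locales (auto simp: H'_def H.wellformed)
  have ends: "arcs_ends H' = (\<lambda>a. (tail H a, head H a)) ` B"
    by (auto simp: arcs_ends_def arc_to_ends_def H'_def)
  have "(v, v) \<notin> (arcs_ends H')\<^sup>+" for v
  proof
    assume "(v, v) \<in> (arcs_ends H')\<^sup>+"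
    then obtain p where "H'.awalk v p v" "p \<noteq> []"
      using H'.reachable1_awalk by blast
    then have "H'.closed_w p" by (auto simp: H'.closed_w_def)
    then obtain c where c: "H'.cycle c" using H'.closed_w_imp_cycle by blast
    have "subgraph H' H"
      using assms(2) H'.wf_digraph_axioms H.wf_digraph_axioms
      by (auto simp: subgraph_def H'_def compatible_def)
    then have "H.cycle c" using c H.subgraph_cycle by blast
    moreover have "set c \<subseteq> arcs H'"
      using c unfolding H'.cycle_def H'.awalk_def by blast
    then have "set c \<subseteq> B" by (simp add: H'_def)
    ultimately show False using assms(3) by blast
  qed
  then show ?thesis by (simp add: acyclic_def flip: ends)
qed

text \<open>Along a walk \<open>f\<close> grows by at least the length of the walk, which is
  impossible on a nonempty closed walk.\<close>

lemma ranked_arcs_no_cycle: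
  fixes f :: "'a \<Rightarrow> nat"
  assumes "\<And>a. a \<in> B \<Longrightarrow> f (tail H a) < f (head H a)"
  shows "\<not> (\<exists>p. pre_digraph.cycle H p \<and> set p \<subseteq> B)"
proof safe
  have mono: "f u + length p \<le> f v" if "pre_digraph.cas H u p v" "set p \<subseteq> B" for u p v
    using that
  proof (induction p arbitrary: u)
    case Nil
    then show ?case by (simp add: pre_digraph.cas.simps)
  next
    case (Cons a p)
    then show ?case using assms[of a] by (fastforce simp: pre_digraph.cas.simps)
  qed
  fix p assume "pre_digraph.cycle H p" "set p \<subseteq> B"
  then obtain u where "pre_digraph.cas H u p u" "p \<noteq> []"
    by (auto simp: pre_digraph.cycle_def pre_digraph.awalk_def)
  with mono[of u p u] \<open>set p \<subseteq> B\<close> show False by simp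
qed

text \<open>The acyclic finite relation of \<open>B\<close> is well-founded, so \<open>X\<close> has
  a minimal vertex. It is no root, hence some arc of \<open>B\<close> enters it, and by minimality
  that arc starts outside \<open>X\<close>.\<close>

lemma branching_enters:
  assumes "fin_digraph H" and "branching H B" and "X \<subseteq> verts H" and "X \<noteq> {}"
    and "roots H B \<inter> X = {}"
  shows "delta_in H X \<inter> B \<noteq> {}"
proof -
  interpret fin_digraph H by fact
  let ?r = "(\<lambda>a. (tail H a, head H a)) ` B"
  have B: "B \<subseteq> arcs H" using assms(2) by (simp add: branching_def)
  have "acyclic ?r"
    using acyclic_arcs[OF wf_digraph_axioms B] assms(2) by (auto simp: branching_def)
  moreover have "finite ?r" using B finite_arcs finite_subset by blast
  ultimately have "wf ?r" by (rule finite_acyclic_wf[rotated])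
  then obtain v where v: "v \<in> X" "\<And>u. (u, v) \<in> ?r \<Longrightarrow> u \<notin> X"
    using assms(4) by (rule wfE_min') (erule that)
  have "v \<in> verts H" "v \<notin> roots H B" using v(1) assms(3,5) by auto
  then obtain a where a: "a \<in> B" "head H a = v" "a \<in> arcs H"
    by (auto simp: roots_def in_arcs_def)
  then have "tail H a \<notin> X" using v(2) by blast
  with a v(1) have "a \<in> delta_in H X \<inter> B" by (simp add: delta_in_def)
  then show ?thesis by blast
qed

text \<open>The branching is a breadth-first forest: every vertex outside \<open>R\<close> picks one arc of \<open>X\<close> that
  brings it closer to \<open>R\<close>.\<close>

lemma branching_exists:
  assumes "fin_digraph H" and "X \<subseteq> arcs H" and "R \<subseteq> verts H"
    and enter: "\<And>W. W \<subseteq> verts H \<Longrightarrow> W \<noteq> {} \<Longrightarrow> W \<inter> R = {} \<Longrightarrow> delta_in H W \<inter> X \<noteq> {}"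
  obtains B where "branching H B" and "B \<subseteq> X" and "roots H B = R"
proof -
  interpret fin_digraph H by fact
  let ?r = "(\<lambda>a. (tail H a, head H a)) ` X"
  define reach where "reach n v \<longleftrightarrow> (\<exists>u\<in>R. (u, v) \<in> ?r ^^ n)" for n v
  \<comment> \<open>\<open>f\<close> is the distance from \<open>R\<close> along arcs of
    \<open>X\<close>; it is meaningful at all vertices once \<open>W\<close>, the set of unreachable
    ones, is shown empty.\<close>
  define f where "f v = (LEAST n. reach n v)" for v
  define W where "W = {v \<in> verts H. \<not> (\<exists>n. reach n v)}"
  have reach_Suc: "reach (Suc n) v \<longleftrightarrow> (\<exists>a\<in>X. head H a = v \<and> reach n (tail H a))" for n v
    unfolding reach_def by (auto simp: relcomp_unfold)
  \<comment> \<open>Otherwise an arc of \<open>X\<close> enters \<open>W\<close>; its tail is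
    reachable, and so its head would be too.\<close>
  have "W = {}"
  proof (rule ccontr)
    assume "W \<noteq> {}"
    moreover have "reach 0 v" if "v \<in> R" for v using that by (simp add: reach_def)
    then have "W \<inter> R = {}" by (auto simp: W_def)
    ultimately obtain a where a: "a \<in> X" "a \<in> delta_in H W"
      using enter[of W] by (auto simp: W_def)
    then have "tail H a \<in> verts H" "tail H a \<notin> W" "head H a \<in> W"
      by (auto simp: delta_in_def)
    then obtain n where "reach n (tail H a)" by (auto simp: W_def)
    with a have "reach (Suc n) (head H a)" using reach_Suc by blast
    with \<open>head H a \<in> W\<close> show False by (auto simp: W_def)
  qed
  have "\<exists>a\<in>X. head H a = v \<and> f (tail H a) < f v" if v: "v \<in> verts H - R" for v
  proof -
    have "reach (f v) v"
      using v \<open>W = {}\<close> unfolding f_def W_def by (auto intro: LeastI)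
    moreover have "f v \<noteq> 0"
      using calculation v by (metis DiffD2 reach_def relpow_0_E)
    ultimately obtain n where n: "f v = Suc n" "reach (Suc n) v"
      by (metis not0_implies_Suc)
    then obtain a where "a \<in> X" "head H a = v" "reach n (tail H a)"
      using reach_Suc by blast
    moreover from this have "f (tail H a) \<le> n" unfolding f_def by (intro Least_le)
    ultimately show ?thesis using n by auto
  qed
  then obtain par where par: "\<And>v. v \<in> verts H - R \<Longrightarrow>
      par v \<in> X \<and> head H (par v) = v \<and> f (tail H (par v)) < f v"
    by metis
  define B where "B = par ` (verts H - R)"
  have "B \<subseteq> X" using par by (auto simp: B_def)
  have in_B: "in_arcs H v \<inter> B = (if v \<in> R then {} else {par v})" if "v \<in> verts H" for v
    using par that \<open>X \<subseteq> arcs H\<close> by (auto simp: B_def in_arcs_def)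
  have "\<not> (\<exists>p. pre_digraph.cycle H p \<and> set p \<subseteq> B)"
    by (rule ranked_arcs_no_cycle[of _ f]) (use par in \<open>auto simp: B_def\<close>)
  then have "branching H B"
    using \<open>B \<subseteq> X\<close> \<open>X \<subseteq> arcs H\<close> in_B by (auto simp: branching_def)
  moreover have "roots H B = {v \<in> verts H. v \<in> R}"
    unfolding roots_def using in_B by (intro Collect_cong) (simp cong: conj_cong)
  then have "roots H B = R" using \<open>R \<subseteq> verts H\<close> by blast
  ultimately show thesis using that \<open>B \<subseteq> X\<close> by blast
qed


section \<open>The functions \<open>g_S\<close> and \<open>g_T\<close>\<close>

lemma reverse_digraph_simps [simp]:
  "verts (reverse_digraph G) = verts G" "arcs (reverse_digraph G) = arcs G"
  "tail (reverse_digraph G) = head G" "head (reverse_digraph G) = tail G"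
  by (simp_all add: reverse_digraph_def)

lemma fin_digraph_reverse: "fin_digraph G \<Longrightarrow> fin_digraph (reverse_digraph G)"
  by (auto simp: fin_digraph_def fin_digraph_axioms_def wf_digraph_def)

lemma delta_in_reverse [simp]: "delta_in (reverse_digraph G) X = delta_out G X"
  by (auto simp: delta_in_def delta_out_def)

lemma delta_out_reverse [simp]: "delta_out (reverse_digraph G) X = delta_in G X"
  by (auto simp: delta_in_def delta_out_def)

lemma arcs_between_reverse [simp]: "arcs_between (reverse_digraph G) T S = arcs_between G S T"
  by (auto simp: arcs_between_def)

lemma induce_reverse: "reverse_digraph G \<restriction> S = reverse_digraph (G \<restriction> S)"
  by (auto simp: reverse_digraph_def induce_subgraph_def)

lemma boundary_reverse: "boundary (reverse_digraph G) T S \<xi> = - boundary G S T \<xi>"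
  by (simp add: boundary_def fun_eq_iff)

text \<open>Reversing all arcs turns cobranchings into branchings, so results on the side of
  \<open>S\<close> follow from those on the side of \<open>T\<close>.\<close>

lemma g_S_conv_g_T: "g_S G w S = g_T (reverse_digraph G) w S"
proof -
  have "cobranching (G \<restriction> S) B = branching (reverse_digraph G \<restriction> S) B"
    and "coroots (G \<restriction> S) B = roots (reverse_digraph G \<restriction> S) B" for B
    by (simp_all add: cobranching_def induce_reverse coroots_def roots_def out_arcs_def in_arcs_def)
  then show ?thesis unfolding g_S_def g_T_def by (intro ext) simp
qed

lemma g_S_shift_conv_g_T_shift:
  "g_S_shift G w S p = g_T_shift (reverse_digraph G) w S (\<lambda>u. - p u)"
proof
  fix \<eta>
  show "g_S_shift G w S p \<eta> = g_T_shift (reverse_digraph G) w S (\<lambda>u. - p u) \<eta>"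
    by (cases "g_T (reverse_digraph G) w S \<eta>")
      (simp_all add: g_S_shift_def g_T_shift_def g_S_conv_g_T sum_negf)
qed

lemma fin_digraph_induce:
  assumes "fin_digraph G" and "T \<subseteq> verts G"
  shows "fin_digraph (G \<restriction> T)"
proof -
  interpret fin_digraph G by fact
  show ?thesis using assms(2) finite_arcs finite_verts
    by unfold_locales (auto intro: finite_subset)
qed

lemma finite_branchings: "fin_digraph H \<Longrightarrow> finite {B. branching H B \<and> P B}"
  by (rule finite_subset[of _ "Pow (arcs H)"])
    (auto simp: branching_def fin_digraph.finite_arcs)

text \<open>There are finitely many branchings, so a finite value is attained by one of
  them.\<close>

lemma g_T_cases:
  assumes "fin_digraph G" and "T \<subseteq> verts G"
  obtains (inf) "g_T G w T \<eta> = Pinf"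
  | (fin) B where "g_T G w T \<eta> = Fin (\<Sum>a\<in>B. w a)" and "\<forall>v\<in>T. \<eta> v \<ge> 0"
    and "branching (G \<restriction> T) B" and "roots (G \<restriction> T) B = supp_plus T \<eta>"
proof -
  let ?\<B> = "{B. branching (G \<restriction> T) B \<and> roots (G \<restriction> T) B = supp_plus T \<eta>}"
  show thesis
  proof (cases "(\<forall>v\<in>T. \<eta> v \<ge> 0) \<and> ?\<B> \<noteq> {}")
    case True
    then have "Min ((\<lambda>B. \<Sum>a\<in>B. w a) ` ?\<B>) \<in> (\<lambda>B. \<Sum>a\<in>B. w a) ` ?\<B>"
      using finite_branchings[OF fin_digraph_induce[OF assms]] by (intro Min_in) auto
    then obtain B where "B \<in> ?\<B>" "Min ((\<lambda>B. \<Sum>a\<in>B. w a) ` ?\<B>) = (\<Sum>a\<in>B. w a)"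
      by blast
    with True show thesis by (intro fin[of B]) (auto simp: g_T_def Let_def)
  next
    case False
    then show thesis by (intro inf) (auto simp: g_T_def Let_def)
  qed
qed

lemma g_T_le:
  assumes "fin_digraph G" and "T \<subseteq> verts G" and "\<forall>v\<in>T. \<eta> v \<ge> 0"
    and "branching (G \<restriction> T) B" and "roots (G \<restriction> T) B = supp_plus T \<eta>"
  shows "g_T G w T \<eta> \<le> Fin (\<Sum>a\<in>B. w a)"
proof -
  let ?\<B> = "{B. branching (G \<restriction> T) B \<and> roots (G \<restriction> T) B = supp_plus T \<eta>}"
  have "Min ((\<lambda>B. \<Sum>a\<in>B. w a) ` ?\<B>) \<le> (\<Sum>a\<in>B. w a)"
    using assms finite_branchings[OF fin_digraph_induce[OF assms(1,2)]] by (intro Min_le) auto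
  moreover have "g_T G w T \<eta> = Fin (Min ((\<lambda>B. \<Sum>a\<in>B. w a) ` ?\<B>))"
    using assms(3-5) by (auto simp: g_T_def Let_def)
  ultimately show ?thesis by simp
qed

text \<open>Every set \<open>T'\<close> is entered by an arc of the branching or contains one of its roots, so it is
  paid for by the arcs or by the term \<open>q\<close>.\<close>

lemma g_T_shift_lower:
  assumes "fin_digraph G" and "T \<subseteq> verts G"
    and dual: "\<And>a. a \<in> arcs (G \<restriction> T) \<Longrightarrow>
      (\<Sum>T' | T' \<noteq> {} \<and> T' \<subseteq> T \<and> a \<in> delta_in G T'. z T') \<le> w a"
    and z: "\<And>T'. T' \<noteq> {} \<Longrightarrow> T' \<subseteq> T \<Longrightarrow> z T' \<ge> 0"
    and q: "\<And>v. v \<in> T \<Longrightarrow> q v = (\<Sum>T' | T' \<subseteq> T \<and> v \<in> T'. z T')"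
  shows "Fin (\<Sum>T' | T' \<noteq> {} \<and> T' \<subseteq> T. z T') \<le> g_T_shift G w T q \<eta>"
  using assms(1,2)
proof (cases rule: g_T_cases[where w = w and \<eta> = \<eta>])
  case inf
  then show ?thesis by (simp add: g_T_shift_def)
next
  case (fin B)
  have finT: "finite T"
    using assms(1,2) fin_digraph.finite_verts finite_subset by blast
  have B: "B \<subseteq> arcs (G \<restriction> T)" using fin(3) by (simp add: branching_def)
  then have finB: "finite B"
    using fin_digraph.finite_arcs[OF fin_digraph_induce[OF assms(1,2)]] finite_subset by blast
  define F where "F = {T'. T' \<noteq> {} \<and> T' \<subseteq> T}"
  have finF: "finite F" unfolding F_def using finT by (auto intro: finite_subset[of _ "Pow T"])
  have covered: "1 \<le> int (card (B \<inter> delta_in G T')) + (\<Sum>v\<in>T'. \<eta> v)" if "T' \<in> F" for T'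
  proof -
    from that have T': "T' \<noteq> {}" "T' \<subseteq> T" by (auto simp: F_def)
    have pos: "(\<Sum>v\<in>T'. \<eta> v) \<ge> 0"
      using T' fin(2) by (intro sum_nonneg) auto
    show ?thesis
    proof (cases "supp_plus T \<eta> \<inter> T' = {}")
      case True
      then have "delta_in (G \<restriction> T) T' \<inter> B \<noteq> {}"
        using branching_enters[OF fin_digraph_induce[OF assms(1,2)] fin(3), of T'] T' fin(4)
        by simp
      then have "B \<inter> delta_in G T' \<noteq> {}" by (auto simp: delta_in_def)
      then have "card (B \<inter> delta_in G T') > 0" using finB by (simp add: card_gt_0_iff)
      with pos show ?thesis by linarith
    next
      case False
      then obtain v where v: "v \<in> T'" "\<eta> v > 0" by (auto simp: supp_plus_def)
      then have "\<eta> v \<le> (\<Sum>v\<in>T'. \<eta> v)"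
        using T' fin(2) finT finite_subset by (intro member_le_sum) auto
      with v show ?thesis by linarith
    qed
  qed
  \<comment> \<open>Weak duality: the covering inequalities are weighted by \<open>z\<close> and the
    sums are exchanged. Each arc then collects its dual load, at most \<open>w a\<close>, and each
    vertex collects \<open>q v\<close>.\<close>
  have "(\<Sum>T'\<in>F. z T')
      \<le> (\<Sum>T'\<in>F. z T' * (int (card (B \<inter> delta_in G T')) + (\<Sum>v\<in>T'. \<eta> v)))"
  proof (rule sum_mono)
    fix T' assume "T' \<in> F"
    then show "z T' \<le> z T' * (int (card (B \<inter> delta_in G T')) + (\<Sum>v\<in>T'. \<eta> v))"
      using mult_left_mono[OF covered, of T' "z T'"] z by (simp add: F_def)
  qed
  also have "\<dots> = (\<Sum>T'\<in>F. \<Sum>a | a \<in> B \<and> a \<in> delta_in G T'. z T')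
      + (\<Sum>T'\<in>F. \<Sum>v | v \<in> T \<and> v \<in> T'. z T' * \<eta> v)"
  proof -
    have "{v. v \<in> T \<and> v \<in> T'} = T'" if "T' \<in> F" for T' using that by (auto simp: F_def)
    moreover have "{a. a \<in> B \<and> a \<in> delta_in G T'} = B \<inter> delta_in G T'" for T' by auto
    ultimately show ?thesis
      by (simp add: algebra_simps sum.distrib sum_distrib_left)
  qed
  also have "(\<Sum>T'\<in>F. \<Sum>a | a \<in> B \<and> a \<in> delta_in G T'. z T')
      = (\<Sum>a\<in>B. \<Sum>T' | T' \<in> F \<and> a \<in> delta_in G T'. z T')"
    using finF finB by (rule sum.swap_restrict)
  also have "(\<Sum>T'\<in>F. \<Sum>v | v \<in> T \<and> v \<in> T'. z T' * \<eta> v)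
      = (\<Sum>v\<in>T. \<Sum>T' | T' \<in> F \<and> v \<in> T'. z T' * \<eta> v)"
    using finF finT by (rule sum.swap_restrict)
  also have "\<dots> = (\<Sum>v\<in>T. q v * \<eta> v)"
  proof (rule sum.cong)
    fix v assume "v \<in> T"
    have "{T'. T' \<in> F \<and> v \<in> T'} = {T'. T' \<subseteq> T \<and> v \<in> T'}" by (auto simp: F_def)
    with q[OF \<open>v \<in> T\<close>] show "(\<Sum>T' | T' \<in> F \<and> v \<in> T'. z T' * \<eta> v) = q v * \<eta> v"
      by (simp add: sum_distrib_right)
  qed simp
  also have "(\<Sum>a\<in>B. \<Sum>T' | T' \<in> F \<and> a \<in> delta_in G T'. z T') \<le> (\<Sum>a\<in>B. w a)"
    using dual B by (intro sum_mono) (auto simp: F_def conj_assoc)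
  finally show ?thesis using fin(1) by (simp add: g_T_shift_def F_def)
qed

text \<open>An arc with \<open>x = 1\<close> that comes from outside \<open>T\<close> has its head
  in the support of \<open>\<eta>\<close>. Hence a set avoiding that support is entered from within
  \<open>T\<close>, and the chosen arcs of \<open>D[T]\<close> contain a branching with the required
  roots. Dropping the others does not raise the cost since \<open>w\<close> is nonnegative.\<close>

lemma g_T_upper:
  fixes w x :: "'b \<Rightarrow> int"
  assumes "fin_digraph G" and "T \<subseteq> verts G" and w: "\<forall>a\<in>arcs G. w a \<ge> 0"
    and x: "\<forall>a\<in>arcs G. x a \<in> {0, 1}"
    and enter: "\<And>T'. T' \<noteq> {} \<Longrightarrow> T' \<subseteq> T \<Longrightarrow> \<exists>a\<in>delta_in G T'. x a = 1"
    and \<eta>: "\<forall>v\<in>T. \<eta> v \<ge> 0" "supp_plus T \<eta> = head G ` {a \<in> delta_in G T. x a = 1}"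
  shows "g_T G w T \<eta> \<le> Fin (\<Sum>a\<in>arcs (G \<restriction> T). w a * x a)"
proof -
  let ?X = "{a \<in> arcs (G \<restriction> T). x a = 1}"
  have H: "fin_digraph (G \<restriction> T)" using assms(1,2) by (rule fin_digraph_induce)
  then have finH: "finite (arcs (G \<restriction> T))" by (rule fin_digraph.finite_arcs)
  have "delta_in (G \<restriction> T) W \<inter> ?X \<noteq> {}"
    if W: "W \<subseteq> T" "W \<noteq> {}" "W \<inter> supp_plus T \<eta> = {}" for W
  proof -
    obtain a where a: "a \<in> delta_in G W" "x a = 1" using enter W by blast
    have "tail G a \<in> T"
      using a W \<eta>(2) by (auto simp: delta_in_def)
    with a W have "a \<in> delta_in (G \<restriction> T) W \<inter> ?X" by (auto simp: delta_in_def)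
    then show ?thesis by blast
  qed
  then obtain B where B: "branching (G \<restriction> T) B" "B \<subseteq> ?X" "roots (G \<restriction> T) B = supp_plus T \<eta>"
    using branching_exists[OF H, of ?X "supp_plus T \<eta>"] by (auto simp: supp_plus_def)
  have "(\<Sum>a\<in>B. w a) \<le> (\<Sum>a\<in>?X. w a)"
    using B(2) w finite_subset[OF _ finH, of ?X] by (intro sum_mono2) auto
  also have "\<dots> = (\<Sum>a\<in>arcs (G \<restriction> T). w a * x a)"
    using x finH by (intro sum.mono_neutral_cong_left) auto
  finally show ?thesis
    using g_T_le[OF assms(1,2) \<eta>(1) B(1,3), of w] by (metis less_eq_extended.simps(1) order_trans)
qed

section \<open>Boundaries of flows\<close>

lemma boundary_head:
  assumes "S \<inter> T = {}" and "v \<in> T"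
  shows "- boundary G S T \<xi> v = int (card {a \<in> arcs_between G S T. \<xi> a = 1 \<and> head G a = v})"
proof -
  have "{a \<in> delta_out G {v} \<inter> arcs_between G S T. \<xi> a = 1} = {}"
    and "{a \<in> delta_in G {v} \<inter> arcs_between G S T. \<xi> a = 1}
      = {a \<in> arcs_between G S T. \<xi> a = 1 \<and> head G a = v}"
    using assms by (auto simp: delta_out_def delta_in_def arcs_between_def)
  then show ?thesis unfolding boundary_def by (simp only: card.empty)
qed

lemma finite_arcs_between: "fin_digraph G \<Longrightarrow> finite (arcs_between G S T)"
  by (auto simp: arcs_between_def intro: finite_subset[OF _ fin_digraph.finite_arcs])

text \<open>Grouping the arcs by their heads turns potential differences on arcs into the linear
  terms of the shifted functions.\<close>

lemma sum_boundary_head: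
  assumes "fin_digraph G" and "T \<subseteq> verts G" and "S \<inter> T = {}" and "binary_flow G S T \<xi>"
  shows "(\<Sum>v\<in>T. q v * (- boundary G S T \<xi>) v) = (\<Sum>a\<in>arcs_between G S T. q (head G a) * \<xi> a)"
proof -
  let ?A = "arcs_between G S T"
  have finA: "finite ?A" using assms(1) by (rule finite_arcs_between)
  have finT: "finite T" using assms(1,2) fin_digraph.finite_verts finite_subset by blast
  have "(\<Sum>a\<in>?A. q (head G a) * \<xi> a)
      = (\<Sum>v\<in>T. \<Sum>a | a \<in> ?A \<and> head G a = v. q (head G a) * \<xi> a)"
    by (rule sum.group[symmetric]) (use finA finT in \<open>auto simp: arcs_between_def\<close>)
  also have "\<dots> = (\<Sum>v\<in>T. q v * (- boundary G S T \<xi>) v)"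
  proof (rule sum.cong)
    fix v assume v: "v \<in> T"
    have "(\<Sum>a | a \<in> ?A \<and> head G a = v. q (head G a) * \<xi> a)
        = (\<Sum>a | a \<in> ?A \<and> \<xi> a = 1 \<and> head G a = v. q v)"
      using finA assms(4) by (intro sum.mono_neutral_cong_right) (auto simp: binary_flow_def)
    then show "(\<Sum>a | a \<in> ?A \<and> head G a = v. q (head G a) * \<xi> a)
        = q v * (- boundary G S T \<xi>) v"
      using boundary_head[OF assms(3) v, of G \<xi>] by (simp add: mult.commute)
  qed simp
  finally show ?thesis by simp
qed

lemma supp_boundary_head:
  assumes "fin_digraph G" and "S \<union> T = verts G" and "S \<inter> T = {}"
    and "\<forall>a\<in>arcs_between G S T. \<xi> a = x a"
  shows "supp_plus T (- boundary G S T \<xi>) = head G ` {a \<in> delta_in G T. x a = 1}"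
proof -
  \<comment> \<open>An arc entering \<open>T\<close> from outside must start in \<open>S\<close>, as
    the two sets cover all vertices.\<close>
  have AB: "delta_in G T = arcs_between G S T"
    using assms(1-3) by (auto simp: delta_in_def arcs_between_def fin_digraph_def wf_digraph_def)
  have "(0 < (- boundary G S T \<xi>) v) \<longleftrightarrow> v \<in> head G ` {a \<in> delta_in G T. x a = 1}"
    if "v \<in> T" for v
    using boundary_head[OF assms(3) that, of G \<xi>] finite_arcs_between[OF assms(1), of S T] assms(4)
    by (force simp: AB card_gt_0_iff)
  then show ?thesis by (auto simp: supp_plus_def delta_in_def)
qed

section \<open>Complementary slackness\<close>

text \<open>Strong duality yields a real dual solution worth at least the primal optimum, and
  \<open>(y, z)\<close> is optimal among all real dual solutions.\<close>

lemma primal_le_dual: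
  fixes w x :: "'b \<Rightarrow> int" and y z :: "'a set \<Rightarrow> int"
  assumes "fin_digraph G" and "S \<union> T = verts G"
    and primal: "primal_optimal G w S T (\<lambda>a. real_of_int (x a))"
    and dual: "dual_optimal G w S T (\<lambda>S'. real_of_int (y S'), \<lambda>T'. real_of_int (z T'))"
  shows "(\<Sum>a\<in>arcs G. w a * x a)
    \<le> (\<Sum>S' | S' \<noteq> {} \<and> S' \<subseteq> S. y S') + (\<Sum>T' | T' \<noteq> {} \<and> T' \<subseteq> T. z T')"
proof -
  define FS where "FS = {S'. S' \<noteq> {} \<and> S' \<subseteq> S}"
  define FT where "FT = {T'. T' \<noteq> {} \<and> T' \<subseteq> T}"
  \<comment> \<open>The constraint matrix of (P): one row for each nonempty subset of
    \<open>S\<close> and of \<open>T\<close>.\<close>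
  define A where "A = case_sum (\<lambda>S' a. of_bool (a \<in> delta_out G S') :: real)
    (\<lambda>T' a. of_bool (a \<in> delta_in G T'))"
  have fin: "finite (arcs G)" "finite FS" "finite FT"
    using fin_digraph.finite_arcs[OF assms(1)] fin_digraph.finite_verts[OF assms(1)] assms(2)
    by (auto simp: FS_def FT_def intro!: finite_subset[of _ "Pow (verts G)"])
  have sub: "delta_out G X \<subseteq> arcs G" "delta_in G X \<subseteq> arcs G" for X
    by (auto simp: delta_out_def delta_in_def)
  have AS: "(\<Sum>a\<in>arcs G. A (Inl X) a * x' a) = (\<Sum>a\<in>delta_out G X. x' a)"
    and AT: "(\<Sum>a\<in>arcs G. A (Inr X) a * x' a) = (\<Sum>a\<in>delta_in G X. x' a)" for X x'
    using fin(1) sub[of X] by (auto simp: A_def intro!: sum.mono_neutral_cong_right)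
  have feas: "primal_feasible G S T x' \<longleftrightarrow>
      (\<forall>i\<in>FS <+> FT. (\<Sum>a\<in>arcs G. A i a * x' a) \<ge> 1) \<and> (\<forall>a\<in>arcs G. x' a \<ge> 0)" for x'
    unfolding primal_feasible_def FS_def FT_def Plus_def ball_Un
    by (simp add: AS AT)
  obtain l where l: "\<And>i. i \<in> FS <+> FT \<Longrightarrow> l i \<ge> 0"
      "\<And>a. a \<in> arcs G \<Longrightarrow> (\<Sum>i\<in>FS <+> FT. l i * A i a) \<le> real_of_int (w a)"
      "(\<Sum>i\<in>FS <+> FT. l i * 1) \<ge> (\<Sum>a\<in>arcs G. real_of_int (w a) * real_of_int (x a))"
    by (rule lp_strong_duality[of "FS <+> FT" "arcs G" "\<lambda>_. 1" A "\<lambda>a. real_of_int (x a)"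
          "\<lambda>a. real_of_int (w a)"])
      (use fin primal in \<open>auto simp: primal_optimal_def is_arg_min_linorder feas\<close>)
  have "dual_feasible G w S T (\<lambda>S'. l (Inl S'), \<lambda>T'. l (Inr T'))"
  proof -
    have "(\<Sum>S' | S' \<noteq> {} \<and> S' \<subseteq> S \<and> a \<in> delta_out G S'. l (Inl S'))
        + (\<Sum>T' | T' \<noteq> {} \<and> T' \<subseteq> T \<and> a \<in> delta_in G T'. l (Inr T'))
        = (\<Sum>i\<in>FS <+> FT. l i * A i a)" for a
    proof -
      have "(\<Sum>S' | S' \<noteq> {} \<and> S' \<subseteq> S \<and> a \<in> delta_out G S'. l (Inl S'))
          = (\<Sum>S'\<in>FS. l (Inl S') * A (Inl S') a)"
        and "(\<Sum>T' | T' \<noteq> {} \<and> T' \<subseteq> T \<and> a \<in> delta_in G T'. l (Inr T'))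
          = (\<Sum>T'\<in>FT. l (Inr T') * A (Inr T') a)"
        using fin by (auto simp: A_def FS_def FT_def intro!: sum.mono_neutral_cong_left)
      then show ?thesis using fin by (simp add: sum.Plus)
    qed
    with l show ?thesis by (auto simp: dual_feasible_def FS_def FT_def InlI InrI)
  qed
  with dual have "(\<Sum>S'\<in>FS. l (Inl S')) + (\<Sum>T'\<in>FT. l (Inr T'))
      \<le> (\<Sum>S'\<in>FS. real_of_int (y S')) + (\<Sum>T'\<in>FT. real_of_int (z T'))"
    unfolding dual_optimal_def is_arg_max_linorder FS_def FT_def by fastforce
  with l(3) fin have "real_of_int (\<Sum>a\<in>arcs G. w a * x a)
      \<le> real_of_int ((\<Sum>S'\<in>FS. y S') + (\<Sum>T'\<in>FT. z T'))"
    by (simp add: sum.Plus)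
  then show ?thesis unfolding FS_def FT_def of_int_le_iff .
qed

theorem theorem4:
  fixes G :: "('a,'b) pre_digraph"
    and S T :: "'a set"
    and w x \<xi> :: "'b \<Rightarrow> int"
    and y z :: "'a set \<Rightarrow> int"
    and p q :: "'a \<Rightarrow> int"
  assumes "fin_digraph G"
    and "S \<union> T = verts G" and "S \<inter> T = {}" and "S \<noteq> {}" and "T \<noteq> {}"
    and "\<not> (\<exists>a\<in>arcs G. tail G a \<in> T \<and> head G a \<in> S)"
    and "\<forall>a\<in>arcs G. w a \<ge> 0"
    and "\<forall>a\<in>arcs G. x a \<in> {0, 1}"
    and "primal_optimal G w S T (\<lambda>a. real_of_int (x a))"
    and "dual_optimal G w S T (\<lambda>S'. real_of_int (y S'), \<lambda>T'. real_of_int (z T'))"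
    and "\<forall>a\<in>arcs_between G S T. \<xi> a = x a"
    and "\<forall>u\<in>S. p u = - (\<Sum>S' | S' \<subseteq> S \<and> u \<in> S'. y S')"
    and "\<forall>v\<in>T. q v = (\<Sum>T' | T' \<subseteq> T \<and> v \<in> T'. z T')"
  shows "optimal_flow G w S T \<xi> \<and> optimal_potential G w S T (p, q)"
proof -
  let ?G = "reverse_digraph G" and ?A = "arcs_between G S T"
  define Y where "Y = (\<Sum>S' | S' \<noteq> {} \<and> S' \<subseteq> S. y S')"
  define Z where "Z = (\<Sum>T' | T' \<noteq> {} \<and> T' \<subseteq> T. z T')"
  define c where "c a = w a + p (tail G a) - q (head G a)" for a
  note rev = fin_digraph_reverse[OF assms(1)]
  have ST: "S \<subseteq> verts G" "T \<subseteq> verts G" "S \<subseteq> verts ?G" "T \<inter> S = {}" "T \<union> S = verts ?G"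
    using assms(2,3) by auto
  have finA: "finite ?A" using assms(1) by (rule finite_arcs_between)
  have xA: "\<forall>a\<in>arcs_between ?G T S. \<xi> a = x a" using assms(11) by simp
  have bin: "binary_flow G S T \<xi>"
    using assms(8,11) by (auto simp: binary_flow_def arcs_between_def)

  have "dual_feasible G w S T (\<lambda>S'. real_of_int (y S'), \<lambda>T'. real_of_int (z T'))"
    using assms(10) by (simp add: dual_optimal_def is_arg_max_def)
  then have dual: "\<And>a. a \<in> arcs G \<Longrightarrow>
        (\<Sum>S' | S' \<noteq> {} \<and> S' \<subseteq> S \<and> a \<in> delta_out G S'. y S') +
        (\<Sum>T' | T' \<noteq> {} \<and> T' \<subseteq> T \<and> a \<in> delta_in G T'. z T') \<le> w a"
    and y: "\<And>S'. S' \<noteq> {} \<Longrightarrow> S' \<subseteq> S \<Longrightarrow> y S' \<ge> 0"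
    and z: "\<And>T'. T' \<noteq> {} \<Longrightarrow> T' \<subseteq> T \<Longrightarrow> z T' \<ge> 0"
    unfolding dual_feasible_def by (simp_all flip: of_int_sum of_int_add)
  \<comment> \<open>An arc from \<open>S\<close> to \<open>T\<close> leaves exactly the subsets of
    \<open>S\<close> containing its tail and enters exactly the subsets of \<open>T\<close>
    containing its head, so its dual constraint is nonnegativity of the reduced cost.\<close>
  have c: "c a \<ge> 0" if "a \<in> ?A" for a
  proof -
    have "{S'. S' \<noteq> {} \<and> S' \<subseteq> S \<and> a \<in> delta_out G S'} = {S'. S' \<subseteq> S \<and> tail G a \<in> S'}"
      and "{T'. T' \<noteq> {} \<and> T' \<subseteq> T \<and> a \<in> delta_in G T'} = {T'. T' \<subseteq> T \<and> head G a \<in> T'}"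
      using that assms(3) by (auto simp: arcs_between_def delta_in_def delta_out_def)
    with dual[of a] that assms(12,13) show ?thesis by (simp add: c_def arcs_between_def)
  qed
  \<comment> \<open>An arc inside \<open>S\<close> enters no subset of \<open>T\<close>, so only the
    \<open>y\<close> part of its dual constraint survives.\<close>
  have lowS: "Fin Y \<le> g_S_shift G w S p \<eta>" for \<eta>
    unfolding g_S_shift_conv_g_T_shift Y_def
  proof (rule g_T_shift_lower[OF rev ST(3)])
    fix a assume a: "a \<in> arcs (?G \<restriction> S)"
    then have "{T'. T' \<noteq> {} \<and> T' \<subseteq> T \<and> a \<in> delta_in G T'} = {}"
      using assms(3) by (auto simp: delta_in_def)
    with dual[of a] a
    show "(\<Sum>S' | S' \<noteq> {} \<and> S' \<subseteq> S \<and> a \<in> delta_in ?G S'. y S') \<le> w a"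
      by (simp only: delta_in_reverse) simp
  qed (use y assms(12) in auto)
  have lowT: "Fin Z \<le> g_T_shift G w T q \<eta>" for \<eta>
    unfolding Z_def
  proof (rule g_T_shift_lower[OF assms(1) ST(2)])
    fix a assume a: "a \<in> arcs (G \<restriction> T)"
    then have "{S'. S' \<noteq> {} \<and> S' \<subseteq> S \<and> a \<in> delta_out G S'} = {}"
      using assms(3) by (auto simp: delta_out_def)
    with dual[of a] a
    show "(\<Sum>T' | T' \<noteq> {} \<and> T' \<subseteq> T \<and> a \<in> delta_in G T'. z T') \<le> w a"
      by simp
  qed (use z assms(13) in auto)

  have sum_c: "(\<Sum>a\<in>?A. c a * \<xi>' a) = (\<Sum>a\<in>?A. w a * \<xi>' a)
      + (\<Sum>u\<in>S. p u * boundary G S T \<xi>' u) - (\<Sum>v\<in>T. q v * (- boundary G S T \<xi>') v)"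
    if "binary_flow G S T \<xi>'" for \<xi>'
  proof -
    have "binary_flow ?G T S \<xi>'" using that by (simp add: binary_flow_def)
    then have "(\<Sum>u\<in>S. p u * boundary G S T \<xi>' u) = (\<Sum>a\<in>?A. p (tail G a) * \<xi>' a)"
      using sum_boundary_head[OF rev ST(3,4), of \<xi>' p] by (simp add: boundary_reverse)
    moreover have "(\<Sum>v\<in>T. q v * (- boundary G S T \<xi>') v) = (\<Sum>a\<in>?A. q (head G a) * \<xi>' a)"
      using sum_boundary_head[OF assms(1) ST(2) assms(3) that, of q] .
    ultimately show ?thesis
      by (simp only: c_def) (simp add: algebra_simps sum.distrib sum_subtractf)
  qed
  have c_nonneg: "c a * \<xi>' a \<ge> 0" if "binary_flow G S T \<xi>'" "a \<in> ?A" for \<xi>' a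
    using that c by (force simp: binary_flow_def)
  have low: "Fin (Y + Z) \<le> msf_cost G w S T \<xi>'" if "binary_flow G S T \<xi>'" for \<xi>'
  proof -
    have "(\<Sum>a\<in>?A. c a * \<xi>' a) \<ge> 0"
      using c_nonneg[OF that] by (rule sum_nonneg)
    with sum_c[OF that] lowS[of "boundary G S T \<xi>'"] lowT[of "- boundary G S T \<xi>'"]
    show ?thesis
      unfolding msf_cost_def g_S_shift_def g_T_shift_def
      by (cases "g_S G w S (boundary G S T \<xi>')"; cases "g_T G w T (- boundary G S T \<xi>')") auto
  qed

  have feas: "primal_feasible G S T (\<lambda>a. real_of_int (x a))"
    using assms(9) by (simp add: primal_optimal_def is_arg_min_def)
  have ex1: "\<exists>a\<in>X. x a = 1" if "(\<Sum>a\<in>X. real_of_int (x a)) \<ge> 1" "X \<subseteq> arcs G" for X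
  proof (rule ccontr)
    assume "\<not> ?thesis"
    then have "\<forall>a\<in>X. x a = 0" using assms(8) that(2) by auto
    with that(1) show False by simp
  qed
  have sub: "delta_out G X \<subseteq> arcs G" "delta_in G X \<subseteq> arcs G" for X
    by (auto simp: delta_out_def delta_in_def)
  have "g_T ?G w S (- boundary ?G T S \<xi>) \<le> Fin (\<Sum>a\<in>arcs (?G \<restriction> S). w a * x a)"
  proof (rule g_T_upper[OF rev ST(3)])
    show "\<forall>u\<in>S. (- boundary ?G T S \<xi>) u \<ge> 0"
      using boundary_head[OF ST(4), of _ ?G \<xi>] by simp
    show "supp_plus S (- boundary ?G T S \<xi>) = head ?G ` {a \<in> delta_in ?G S. x a = 1}"
      using supp_boundary_head[OF rev ST(5,4) xA] .
    show "\<exists>a\<in>delta_in ?G S'. x a = 1" if "S' \<noteq> {}" "S' \<subseteq> S" for S'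
      using feas that ex1 sub by (simp add: primal_feasible_def)
  qed (use assms(7,8) in auto)
  then have upS: "g_S G w S (boundary G S T \<xi>) \<le> Fin (\<Sum>a\<in>arcs (G \<restriction> S). w a * x a)"
    by (simp add: g_S_conv_g_T boundary_reverse conj_commute fun_Compl_def)
  have upT: "g_T G w T (- boundary G S T \<xi>) \<le> Fin (\<Sum>a\<in>arcs (G \<restriction> T). w a * x a)"
  proof (rule g_T_upper[OF assms(1) ST(2) assms(7,8)])
    show "\<forall>u\<in>T. (- boundary G S T \<xi>) u \<ge> 0"
      using boundary_head[OF assms(3), of _ G \<xi>] by simp
    show "supp_plus T (- boundary G S T \<xi>) = head G ` {a \<in> delta_in G T. x a = 1}"
      using supp_boundary_head[OF assms(1-3,11)] .
    show "\<exists>a\<in>delta_in G T'. x a = 1" if "T' \<noteq> {}" "T' \<subseteq> T" for T'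
      using feas that ex1 sub by (simp add: primal_feasible_def)
  qed
  \<comment> \<open>The upper bounds exclude \<open>Pinf\<close> and the lower bounds exclude
    \<open>Minf\<close>.\<close>
  obtain gs gt where gs: "g_S G w S (boundary G S T \<xi>) = Fin gs"
    and gt: "g_T G w T (- boundary G S T \<xi>) = Fin gt"
    using upS upT lowS[of "boundary G S T \<xi>"] lowT[of "- boundary G S T \<xi>"]
    by (cases "g_S G w S (boundary G S T \<xi>)"; cases "g_T G w T (- boundary G S T \<xi>)")
      (auto simp: g_S_shift_def g_T_shift_def)

  have "(\<Sum>a\<in>arcs G. w a * x a) = (\<Sum>a\<in>?A. w a * \<xi> a)
      + (\<Sum>a\<in>arcs (G \<restriction> S). w a * x a) + (\<Sum>a\<in>arcs (G \<restriction> T). w a * x a)"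
  proof -
    interpret fin_digraph G by fact
    \<comment> \<open>With no arc from \<open>T\<close> to \<open>S\<close>, every arc is of one of
      these three kinds.\<close>
    have arcs: "arcs G = ?A \<union> arcs (G \<restriction> S) \<union> arcs (G \<restriction> T)"
    proof
      show "arcs G \<subseteq> ?A \<union> arcs (G \<restriction> S) \<union> arcs (G \<restriction> T)"
        using assms(2,6) tail_in_verts head_in_verts
        by (fastforce simp: arcs_between_def)
    qed (auto simp: arcs_between_def)
    have "(\<Sum>a\<in>arcs G. w a * x a) = (\<Sum>a\<in>?A. w a * x a)
      + (\<Sum>a\<in>arcs (G \<restriction> S). w a * x a) + (\<Sum>a\<in>arcs (G \<restriction> T). w a * x a)"
      unfolding arcs using assms(3) finA
      by (subst sum.union_disjoint; (subst sum.union_disjoint)?)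
        (auto simp: arcs_between_def)
    then show ?thesis using assms(11) by simp
  qed
  with primal_le_dual[OF assms(1,2,9,10)] upS upT
  have up: "(\<Sum>a\<in>?A. w a * \<xi> a) + gs + gt \<le> Y + Z"
    by (simp add: gs gt Y_def Z_def)
  have "feasible_flow G w S T \<xi>"
    using bin gs gt by (simp add: feasible_flow_def effective_dom_def)
  moreover have "msf_cost G w S T \<xi> \<le> Fin (Y + Z)"
    using up by (simp add: msf_cost_def gs gt)
  then have "is_arg_min (msf_cost G w S T) (binary_flow G S T) \<xi>"
    using bin low by (auto simp: is_arg_min_linorder intro: order_trans)
  moreover
  have S: "Y \<le> gs - (\<Sum>u\<in>S. p u * boundary G S T \<xi> u)"
    and T: "Z \<le> gt + (\<Sum>v\<in>T. q v * (- boundary G S T \<xi>) v)"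
    using lowS[of "boundary G S T \<xi>"] lowT[of "- boundary G S T \<xi>"]
    by (simp_all add: g_S_shift_def g_T_shift_def gs gt)
  have c_sum: "(\<Sum>a\<in>?A. c a * \<xi> a) \<ge> 0"
    using c_nonneg[OF bin] by (rule sum_nonneg)
  text \<open>The three slacks are nonnegative and sum to at most zero, so they all vanish.\<close>
  have "(\<Sum>a\<in>?A. c a * \<xi> a) = 0"
    using sum_c[OF bin] up S T c_sum by linarith
  then have "\<forall>a\<in>?A. c a * \<xi> a = 0"
    using c_nonneg[OF bin] finA by (simp add: sum_nonneg_eq_0_iff)
  then have "\<forall>a\<in>?A. (\<xi> a = 1 \<longrightarrow> c a \<le> 0) \<and> (\<xi> a = 0 \<longrightarrow> c a \<ge> 0)"
    using c by auto
  \<comment> \<open>The same slack computation puts both shifted values at their bounds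
    \<open>Y\<close> and \<open>Z\<close>. These bounds hold for every argument, so the minima are
    global.\<close>
  moreover have "g_S_shift G w S p (boundary G S T \<xi>) \<le> Fin Y"
    and "g_T_shift G w T q (- boundary G S T \<xi>) \<le> Fin Z"
    unfolding g_S_shift_def g_T_shift_def gs gt
    using sum_c[OF bin] up S T c_sum by auto
  then have "is_arg_min (g_S_shift G w S p) (\<lambda>_. True) (boundary G S T \<xi>)"
    and "is_arg_min (g_T_shift G w T q) (\<lambda>_. True) (- boundary G S T \<xi>)"
    using lowS lowT by (auto simp: is_arg_min_linorder intro: order_trans)
  ultimately show ?thesis
    unfolding optimal_flow_def optimal_potential_def c_def by auto
qed

end
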